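(* Let $D\subset\mathbb{R}$ be an open interval, let $f:D\to\mathbb{R}$ be an eight times continuously differentiable function with a simple zero $x^{*}\in D$, and let $J:\mathbb{R}^2\to\mathbb{R}$ and $G:\mathbb{R}\to\mathbb{R}$ be sufficiently differentiable functions in a neighborhood of the origin. Write $$J_{i,j}=\left.\frac{\partial^{i+j}J(t,u)}{\partial t^i\,\partial u^j}\right|_{(t,u)=(0,0)},\qquad G_i=\left.\frac{d^iG(s)}{ds^i}\right|_{s=0}.$$ Suppose that $$J_{0,0}=1,\quad J_{1,0}=2,\quad J_{2,0}=8,\quad J_{0,1}=2,\quad J_{3,0}=36,$$ and $$G_0=1,\quad G_1=1.$$ If the initial point $x_0$ is sufficiently close to $x^{*}$, then the sequence $(x_n)$ defined for $n=0,1,2,\dots$ by $$\begin{aligned} y_n&:=x_n-\frac{f(x_n)}{f'(x_n)},\\ z_n&:=y_n-\frac{f(x_n)f(y_n)}{(f(x_n)-f(y_n))^2}\cdot\frac{f(x_n)}{f'(x_n)},\\ x_{n+1}&:=z_n-\frac{f(z_n)}{f'(x_n)}\,J(t_n,u_n)\,G(s_n), \end{aligned}$$ where $$t_n:=\frac{f(y_n)}{f(x_n)},\qquad u_n:=\frac{f(z_n)}{f(x_n)},\qquad s_n:=\frac{f(z_n)}{f(y_n)},$$ converges to $x^{*}$ with order eight.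
   Context: A zero $x^{*}$ of $f$ is simple if $f(x^{*})=0$ and $f'(x^{*})\neq 0$. Convergence with order eight is meant in the usual sense for iterative root-finding methods: $x_n\to x^{*}$ and the errors $e_n:=x_n-x^{*}$ satisfy $e_{n+1}=O(e_n^{8})$. The coefficient of $e_n^8$ in the error equation depends on derivatives of $f$ at $x^{*}$ and may vanish for particular functions $f$. *)

theory Defs
  imports "HOL-Analysis.Analysis" "HOL-Library.Landau_Symbols"
begin

definition simple_zero :: "(real \<Rightarrow> real) \<Rightarrow> real \<Rightarrow> bool" where
  "simple_zero f a \<longleftrightarrow> f a = 0 \<and> deriv f a \<noteq> 0"

(* Intended for open D: then the iterated derivatives at points of D
   depend only on the values of f on D. *)
definition cont_diff_on :: "nat \<Rightarrow> (real \<Rightarrow> real) \<Rightarrow> real set \<Rightarrow> bool" where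
  "cont_diff_on k f D \<longleftrightarrow>
     (\<forall>j<k. \<forall>x\<in>D. (deriv ^^ j) f differentiable (at x)) \<and>
     (\<forall>j\<le>k. continuous_on D ((deriv ^^ j) f))"

definition partial_fst :: "(real \<times> real \<Rightarrow> real) \<Rightarrow> real \<times> real \<Rightarrow> real" where
  "partial_fst F = (\<lambda>(t, u). deriv (\<lambda>t'. F (t', u)) t)"

definition partial_snd :: "(real \<times> real \<Rightarrow> real) \<Rightarrow> real \<times> real \<Rightarrow> real" where
  "partial_snd F = (\<lambda>(t, u). deriv (\<lambda>u'. F (t, u')) u)"

definition mixed_partial :: "nat \<Rightarrow> nat \<Rightarrow> (real \<times> real \<Rightarrow> real) \<Rightarrow> real \<times> real \<Rightarrow> real" where
  "mixed_partial i j F = (partial_fst ^^ i) ((partial_snd ^^ j) F)"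

(* Intended for open U: all partial derivatives of order at most k, with the
   differentiations taken in any order, exist and are continuous on U. *)
primrec cont_diff2_on :: "nat \<Rightarrow> (real \<times> real \<Rightarrow> real) \<Rightarrow> (real \<times> real) set \<Rightarrow> bool" where
  "cont_diff2_on 0 F U \<longleftrightarrow> continuous_on U F"
| "cont_diff2_on (Suc k) F U \<longleftrightarrow>
     continuous_on U F \<and>
     (\<forall>(t, u)\<in>U. (\<lambda>t'. F (t', u)) differentiable (at t) \<and>
                 (\<lambda>u'. F (t, u')) differentiable (at u)) \<and>
     cont_diff2_on k (partial_fst F) U \<and>
     cont_diff2_on k (partial_snd F) U"

definition converges_with_order :: "(nat \<Rightarrow> real) \<Rightarrow> real \<Rightarrow> nat \<Rightarrow> bool" where
  "converges_with_order x a p \<longleftrightarrow>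
     x \<longlonglongrightarrow> a \<and> (\<lambda>n. x (Suc n) - a) \<in> O(\<lambda>n. (x n - a) ^ p)"

end

theory Submission
  imports Defs
begin

text \<open>Let r be the simple zero, e = x - r, and write f(r + h) = k h A(h), f'(r + h) = k B(h) with
k = f'(r). By Taylor's theorem A(h) = 1 + a h + b h^2 + c h^3 + O(h^4), and B(h) expands like
the derivative of h A(h), that is B(h) = 1 + 2 a h + 3 b h^2 + 4 c h^3 + O(h^4). In these terms
every quantity of one step of the method is a quotient that stays meaningful at e = 0: the error of y is e w with w = 1 - A/B,
so w = O(e), and the error of z is e w q with
q = 1 - A(e w) / ((1 - t)^2 B), where t = w A(e w) / A = f(y)/f(x). The first two coefficients of
q cancel, so q = O(e^2) and z is a fourth-order approximation of r.

The error of the full step is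
e w q (1 - A(e w q) / B * J(t, u) G(s)),
and as e w q = O(e^4), it remains to gain four more orders from the last factor. As
A(e w q) = 1 + O(e^4), this means that J(t, u) G(s) has to agree with B = f'(x)/f'(r) up to O(e^4).
Since t = O(e), s = O(e^2) and u = O(e^3), only the terms 1 + 2 t + 4 t^2 + 6 t^3 + 2 u of J and
1 + s of G matter up to that order, and the prescribed values of the partial derivatives are
exactly those coefficients; that the product reproduces B is then a computation with
polynomials modulo e^4 (lemma third_error_bigo).

The computation is organised around expansions modulo O(e^4), which are closed under sums,
products and quotients (cubic_jet). Taylor's theorem supplies the expansions of A, B, J and G
(normalized_simple_zero_exists, cont_diff2_on_weighted_taylor, cont_diff_on_taylor_bigo).
Near r the one-step bound O(e^8) makes the step at least halve the error, so every iterate stays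
where the step is well defined, and the iteration converges
(converges_with_order_if_step_bigo). The points where a quotient degenerates to 0/0, namely x = r
and y = r, do no harm: there all later points equal r.\<close>

section \<open>Third-order expansions\<close>

text \<open>The filter is the full neighbourhood filter of 0, not the punctured one: expansions are later
composed with functions such as e w(e), which tend to 0 but may take the value 0 for e near 0.\<close>

definition cubic_jet :: "(real \<Rightarrow> real) \<Rightarrow> real \<Rightarrow> real \<Rightarrow> real \<Rightarrow> real \<Rightarrow> bool" where
  "cubic_jet F p0 p1 p2 p3 \<longleftrightarrow>
     (\<lambda>e. F e - (p0 + p1 * e + p2 * e ^ 2 + p3 * e ^ 3)) \<in> O[nhds 0](\<lambda>e. e ^ 4)"

lemma bigo_nhds_0_if_tendsto:
  fixes F :: "real \<Rightarrow> real"
  assumes "(F \<longlongrightarrow> l) (nhds 0)"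
  shows "F \<in> O[nhds 0](\<lambda>_. 1)"
proof (rule bigoI)
  show "eventually (\<lambda>e. norm (F e) \<le> (norm l + 1) * norm (1::real)) (nhds 0)"
    using order_tendstoD(2)[OF tendsto_norm[OF assms], of "norm l + 1"]
    by (auto elim!: eventually_mono)
qed

lemma tendsto_0_if_bigo:
  fixes F g :: "real \<Rightarrow> real"
  assumes "F \<in> O[nhds 0](g)" and "(g \<longlongrightarrow> 0) (nhds 0)"
  shows "(F \<longlongrightarrow> 0) (nhds 0)"
proof -
  obtain c where "eventually (\<lambda>e. norm (F e) \<le> c * norm (g e)) (nhds 0)"
    using assms(1) by (auto elim!: landau_o.bigE)
  moreover have "((\<lambda>e. c * norm (g e)) \<longlongrightarrow> 0) (nhds 0)"
    by (intro tendsto_mult_right_zero tendsto_norm_zero assms(2))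
  ultimately show ?thesis by (rule Lim_null_comparison)
qed

lemma bigo_nhds_0_power_mono:
  assumes "n \<le> m"
  shows "(\<lambda>e::real. e ^ m) \<in> O[nhds 0](\<lambda>e. e ^ n)"
proof (rule bigoI[where c = 1])
  have "eventually (\<lambda>e::real. \<bar>e\<bar> < 1) (nhds 0)"
    by (auto simp: eventually_nhds_metric dist_real_def intro!: exI[of _ 1])
  then show "eventually (\<lambda>e::real. norm (e ^ m) \<le> 1 * norm (e ^ n)) (nhds 0)"
    by eventually_elim (use assms in \<open>auto simp: power_abs intro!: power_decreasing\<close>)
qed

lemma cubic_jet_tendsto:
  assumes "cubic_jet F p0 p1 p2 p3"
  shows "(F \<longlongrightarrow> p0) (nhds 0)"
proof -
  have "((\<lambda>e::real. e ^ 4) \<longlongrightarrow> 0) (nhds 0)"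
    by (auto intro!: tendsto_eq_intros filterlim_ident)
  then have r: "((\<lambda>e. F e - (p0 + p1 * e + p2 * e ^ 2 + p3 * e ^ 3)) \<longlongrightarrow> 0) (nhds 0)"
    using assms unfolding cubic_jet_def by (rule tendsto_0_if_bigo[rotated])
  have "((\<lambda>e. p0 + p1 * e + p2 * e ^ 2 + p3 * e ^ 3) \<longlongrightarrow> p0 + p1 * 0 + p2 * 0 ^ 2 + p3 * 0 ^ 3) (nhds 0)"
    by (intro tendsto_intros filterlim_ident)
  from tendsto_add[OF r this] show ?thesis by simp
qed

lemma cubic_jet_bounded:
  assumes "cubic_jet F p0 p1 p2 p3"
  shows "F \<in> O[nhds 0](\<lambda>_. 1)"
  using cubic_jet_tendsto[OF assms] by (rule bigo_nhds_0_if_tendsto)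

lemma cubic_jet_cong_bigo:
  assumes "cubic_jet F p0 p1 p2 p3" and "(\<lambda>e. G e - F e) \<in> O[nhds 0](\<lambda>e. e ^ 4)"
  shows "cubic_jet G p0 p1 p2 p3"
  using sum_in_bigo(1)[OF assms(2) assms(1)[unfolded cubic_jet_def]]
  by (simp add: cubic_jet_def algebra_simps)

lemma cubic_jet_poly:
  "cubic_jet (\<lambda>e. p0 + p1 * e + p2 * e ^ 2 + p3 * e ^ 3) p0 p1 p2 p3"
  by (simp add: cubic_jet_def)

lemma cubic_jet_const: "cubic_jet (\<lambda>_. k) k 0 0 0"
  and cubic_jet_ident: "cubic_jet (\<lambda>e. e) 0 1 0 0"
  using cubic_jet_poly[of k 0 0 0] cubic_jet_poly[of 0 1 0 0] by simp_all

lemma cubic_jet_add: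
  assumes "cubic_jet F p0 p1 p2 p3" and "cubic_jet G q0 q1 q2 q3"
  shows "cubic_jet (\<lambda>e. F e + G e) (p0 + q0) (p1 + q1) (p2 + q2) (p3 + q3)"
  using sum_in_bigo(1)[OF assms[unfolded cubic_jet_def]]
  by (simp add: cubic_jet_def algebra_simps)

lemma cubic_jet_diff:
  assumes "cubic_jet F p0 p1 p2 p3" and "cubic_jet G q0 q1 q2 q3"
  shows "cubic_jet (\<lambda>e. F e - G e) (p0 - q0) (p1 - q1) (p2 - q2) (p3 - q3)"
  using sum_in_bigo(2)[OF assms[unfolded cubic_jet_def]]
  by (simp add: cubic_jet_def algebra_simps)

lemma cubic_jet_mult:
  assumes F: "cubic_jet F p0 p1 p2 p3" and G: "cubic_jet G q0 q1 q2 q3"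
  shows "cubic_jet (\<lambda>e. F e * G e) (p0 * q0) (p0 * q1 + p1 * q0) (p0 * q2 + p1 * q1 + p2 * q0)
           (p0 * q3 + p1 * q2 + p2 * q1 + p3 * q0)"
proof -
  \<comment> \<open>The product of the polynomials differs from its truncation by e^4 times the polynomial R.\<close>
  define P where "P = (\<lambda>e. p0 + p1 * e + p2 * e ^ 2 + p3 * e ^ 3)"
  define Q where "Q = (\<lambda>e. q0 + q1 * e + q2 * e ^ 2 + q3 * e ^ 3)"
  define R where "R = (\<lambda>e. (p1 * q3 + p2 * q2 + p3 * q1) + (p2 * q3 + p3 * q2) * e + p3 * q3 * e ^ 2 + 0 * e ^ 3)"
  have Qb: "Q \<in> O[nhds 0](\<lambda>_. 1)" and Rb: "R \<in> O[nhds 0](\<lambda>_. 1)"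
    unfolding Q_def R_def by (rule cubic_jet_bounded[OF cubic_jet_poly])+
  have "(\<lambda>e. F e * (G e - Q e)) \<in> O[nhds 0](\<lambda>e. 1 * e ^ 4)"
    using G by (intro landau_o.big.mult cubic_jet_bounded[OF F]) (simp add: cubic_jet_def Q_def)
  moreover have "(\<lambda>e. Q e * (F e - P e)) \<in> O[nhds 0](\<lambda>e. 1 * e ^ 4)"
    using F by (intro landau_o.big.mult Qb) (simp add: cubic_jet_def P_def)
  moreover have "(\<lambda>e. R e * e ^ 4) \<in> O[nhds 0](\<lambda>e. 1 * e ^ 4)"
    by (intro landau_o.big.mult Rb) simp
  ultimately have "(\<lambda>e. F e * (G e - Q e) + Q e * (F e - P e) + R e * e ^ 4) \<in> O[nhds 0](\<lambda>e. e ^ 4)"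
    by (simp add: sum_in_bigo)
  also have "(\<lambda>e. F e * (G e - Q e) + Q e * (F e - P e) + R e * e ^ 4) =
     (\<lambda>e. F e * G e - (p0 * q0 + (p0 * q1 + p1 * q0) * e + (p0 * q2 + p1 * q1 + p2 * q0) * e ^ 2
       + (p0 * q3 + p1 * q2 + p2 * q1 + p3 * q0) * e ^ 3))"
    by (rule ext, unfold P_def Q_def R_def) algebra
  finally show ?thesis by (simp add: cubic_jet_def)
qed

text \<open>The coefficients of the quotient are characterised by the product rule instead of being
computed, so that an application only has to verify polynomial identities.\<close>

lemma cubic_jet_divide:
  assumes F: "cubic_jet F p0 p1 p2 p3" and G: "cubic_jet G q0 q1 q2 q3" and "q0 \<noteq> 0"
    and p: "p0 = r0 * q0" "p1 = r0 * q1 + r1 * q0" "p2 = r0 * q2 + r1 * q1 + r2 * q0"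
      "p3 = r0 * q3 + r1 * q2 + r2 * q1 + r3 * q0"
  shows "cubic_jet (\<lambda>e. F e / G e) r0 r1 r2 r3"
proof -
  define R where "R = (\<lambda>e. r0 + r1 * e + r2 * e ^ 2 + r3 * e ^ 3)"
  have G0: "(G \<longlongrightarrow> q0) (nhds 0)" by (rule cubic_jet_tendsto[OF G])
  have inv: "(\<lambda>e. inverse (G e)) \<in> O[nhds 0](\<lambda>_. 1)"
    by (rule bigo_nhds_0_if_tendsto[OF tendsto_inverse[OF G0 \<open>q0 \<noteq> 0\<close>]])
  have "cubic_jet R r0 r1 r2 r3" unfolding R_def by (rule cubic_jet_poly)
  from cubic_jet_diff[OF F cubic_jet_mult[OF this G]]
  have "(\<lambda>e. F e - R e * G e) \<in> O[nhds 0](\<lambda>e. e ^ 4)"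
    by (simp add: cubic_jet_def p)
  from landau_o.big.mult[OF this inv]
  have "(\<lambda>e. (F e - R e * G e) * inverse (G e)) \<in> O[nhds 0](\<lambda>e. e ^ 4)" by simp
  moreover have "eventually (\<lambda>e. G e \<noteq> 0) (nhds 0)"
    using tendsto_imp_eventually_ne[OF G0 \<open>q0 \<noteq> 0\<close>] .
  then have "eventually (\<lambda>e. (F e - R e * G e) * inverse (G e) = F e / G e - R e) (nhds 0)"
    by eventually_elim (simp add: field_simps)
  ultimately show ?thesis
    unfolding cubic_jet_def R_def[symmetric] by (simp add: landau_o.big.in_cong R_def)
qed

lemma cubic_jet_imp_bigo:
  assumes "cubic_jet F p0 p1 p2 p3"
  shows "(\<lambda>e. F e - p0) \<in> O[nhds 0](\<lambda>e. e)"
    and "(\<lambda>e. F e - (p0 + p1 * e)) \<in> O[nhds 0](\<lambda>e. e ^ 2)"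
    and "(\<lambda>e. F e - (p0 + p1 * e + p2 * e ^ 2)) \<in> O[nhds 0](\<lambda>e. e ^ 3)"
proof -
  have pm: "(\<lambda>e. k * e ^ m) \<in> O[nhds 0](\<lambda>e. e ^ n)" if "n \<le> m" for k :: real and m n
    using bigo_nhds_0_power_mono[OF that] by (cases "k = 0") simp_all
  have F: "(\<lambda>e. F e - (p0 + p1 * e + p2 * e ^ 2 + p3 * e ^ 3)) \<in> O[nhds 0](\<lambda>e. e ^ n)" if "n \<le> 4" for n
    using landau_o.big_trans[OF assms[unfolded cubic_jet_def] bigo_nhds_0_power_mono[OF that]] .
  show 3: "(\<lambda>e. F e - (p0 + p1 * e + p2 * e ^ 2)) \<in> O[nhds 0](\<lambda>e. e ^ 3)"
    using sum_in_bigo(1)[OF F[of 3] pm[of 3 3 p3]] by (simp add: algebra_simps)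
  show 2: "(\<lambda>e. F e - (p0 + p1 * e)) \<in> O[nhds 0](\<lambda>e. e ^ 2)"
    using sum_in_bigo(1)[OF landau_o.big_trans[OF 3 bigo_nhds_0_power_mono[of 2 3]] pm[of 2 2 p2]] by (simp add: algebra_simps)
  show "(\<lambda>e. F e - p0) \<in> O[nhds 0](\<lambda>e. e)"
    using sum_in_bigo(1)[OF landau_o.big_trans[OF 2 bigo_nhds_0_power_mono[of 1 2]] pm[of 1 1 p1]] by (simp add: algebra_simps)
qed

lemma cubic_jet_coeffs_cong:
  assumes "cubic_jet F p0 p1 p2 p3" and "p0 = q0" "p1 = q1" "p2 = q2" "p3 = q3"
  shows "cubic_jet F q0 q1 q2 q3"
  using assms by simp

section \<open>Taylor expansions of smooth functions\<close>

lemma cont_diff_on_taylor_bigo: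
  assumes "open D" and f: "cont_diff_on k f D" and "a \<in> D" and "k > 0"
  shows "(\<lambda>h. f (a + h) - (\<Sum>i<k. (deriv ^^ i) f a / fact i * h ^ i)) \<in> O[nhds 0](\<lambda>h. h ^ k)"
proof -
  obtain r where "r > 0" and r: "cball a r \<subseteq> D"
    using \<open>open D\<close> \<open>a \<in> D\<close> by (meson open_contains_cball)
  have "continuous_on (cball a r) ((deriv ^^ k) f)"
    using f r by (auto simp: cont_diff_on_def intro: continuous_on_subset)
  then have "bounded ((deriv ^^ k) f ` cball a r)"
    by (intro compact_imp_bounded compact_continuous_image compact_cball)
  then obtain M where M: "\<And>x. x \<in> cball a r \<Longrightarrow> \<bar>(deriv ^^ k) f x\<bar> \<le> M"
    unfolding bounded_iff by (metis imageI real_norm_def)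
  have der: "DERIV ((deriv ^^ m) f) x :> (deriv ^^ Suc m) f x" if "m < k" "x \<in> cball a r" for m x
    using f that r by (auto simp: cont_diff_on_def DERIV_deriv_iff_real_differentiable)
  have "\<bar>f (a + h) - (\<Sum>i<k. (deriv ^^ i) f a / fact i * h ^ i)\<bar> \<le> M / fact k * \<bar>h ^ k\<bar>"
    if "\<bar>h\<bar> < r" for h
  proof (cases "h = 0")
    case True
    then show ?thesis using \<open>k > 0\<close> by (simp add: sum.lessThan_Suc_shift power_0_left if_distrib cong: if_cong)
  next
    case False
    have "\<exists>t. (if a + h < a then a + h < t \<and> t < a else a < t \<and> t < a + h) \<and>
      f (a + h) = (\<Sum>m<k. ((deriv ^^ m) f a / fact m) * (a + h - a) ^ m)
        + ((deriv ^^ k) f t / fact k) * (a + h - a) ^ k"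
      using \<open>k > 0\<close> that False \<open>r > 0\<close>
      by (intro Taylor[where a = "a - r" and b = "a + r" and diff = "\<lambda>m. (deriv ^^ m) f"])
         (auto intro!: der simp del: funpow.simps simp: dist_real_def)
    then obtain t where t: "if a + h < a then a + h < t \<and> t < a else a < t \<and> t < a + h"
      "f (a + h) - (\<Sum>m<k. ((deriv ^^ m) f a / fact m) * h ^ m) = ((deriv ^^ k) f t / fact k) * h ^ k"
      by auto
    have "t \<in> cball a r" using t(1) that by (auto simp: dist_real_def split: if_splits)
    from M[OF this] show ?thesis
      unfolding t(2) by (simp add: abs_mult mult_right_mono divide_right_mono)
  qed
  moreover have "eventually (\<lambda>h. \<bar>h\<bar> < r) (nhds 0)"
    using \<open>r > 0\<close> by (auto simp: eventually_nhds_metric dist_real_def)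
  ultimately show ?thesis
    by (intro bigoI[where c = "M / fact k"]) (auto elim: eventually_mono)
qed

lemma cont_diff2_on_imp_continuous_on: "cont_diff2_on k F U \<Longrightarrow> continuous_on U F"
  by (cases k) auto

text \<open>Reduces Taylor expansion in the first variable along a horizontal line to the one-variable case.\<close>

lemma iterated_deriv_fst:
  "(deriv ^^ i) (\<lambda>t. F (t, u)) = (\<lambda>t. (partial_fst ^^ i) F (t, u))"
  by (induction i) (simp_all add: partial_fst_def)

lemma cont_diff2_on_partial_fst_iter:
  "cont_diff2_on (i + k) F U \<Longrightarrow> cont_diff2_on k ((partial_fst ^^ i) F) U"
  by (induction i arbitrary: F k) (auto simp del: funpow.simps simp: funpow_Suc_right)

lemma cont_diff_on_fst_slice:
  assumes "cont_diff2_on k F U"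
  shows "cont_diff_on k (\<lambda>t. F (t, u)) {t. (t, u) \<in> U}"
  unfolding cont_diff_on_def iterated_deriv_fst
proof (intro conjI allI impI ballI)
  fix j x assume "j < k" "x \<in> {t. (t, u) \<in> U}"
  moreover have "cont_diff2_on (Suc (k - Suc j)) ((partial_fst ^^ j) F) U"
    using assms \<open>j < k\<close> by (intro cont_diff2_on_partial_fst_iter) simp
  ultimately show "(\<lambda>t. (partial_fst ^^ j) F (t, u)) differentiable (at x)"
    by auto
next
  fix j assume "j \<le> k"
  then have "continuous_on U ((partial_fst ^^ j) F)"
    using assms by (intro cont_diff2_on_imp_continuous_on[of "k - j"] cont_diff2_on_partial_fst_iter) simp
  then show "continuous_on {t. (t, u) \<in> U} (\<lambda>t. (partial_fst ^^ j) F (t, u))"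
    by (auto intro!: continuous_on_compose2[of U] continuous_intros)
qed

text \<open>The symmetric interval serves both signs of h at once.\<close>

lemma mvt_abs_bound:
  fixes g :: "real \<Rightarrow> real"
  assumes "\<And>x. \<bar>x\<bar> \<le> \<bar>h\<bar> \<Longrightarrow> (g has_real_derivative g' x) (at x)"
    and "\<And>x. \<bar>x\<bar> \<le> \<bar>h\<bar> \<Longrightarrow> \<bar>g' x\<bar> \<le> M"
  shows "\<bar>g h - g 0\<bar> \<le> M * \<bar>h\<bar>"
proof -
  have "norm (g h - g 0) \<le> M * norm (h - 0)"
  proof (rule field_differentiable_bound[where S = "cball 0 \<bar>h\<bar>" and f = g and f' = g'])
    show "(g has_field_derivative g' z) (at z within cball 0 \<bar>h\<bar>)" if "z \<in> cball 0 \<bar>h\<bar>" for z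
      by (rule has_field_derivative_at_within[OF assms(1)]) (use that in simp)
    show "norm (g' z) \<le> M" if "z \<in> cball 0 \<bar>h\<bar>" for z
      using assms(2)[of z] that by simp
  qed simp_all
  then show ?thesis by simp
qed

lemma cont_diff2_on_box:
  assumes "open U" and "(0, 0) \<in> U"
  obtains r where "r > 0" and "cball 0 r \<times> cball 0 r \<subseteq> (U :: (real \<times> real) set)"
proof -
  obtain A B where AB: "open A" "open B" "0 \<in> A" "0 \<in> B" "A \<times> B \<subseteq> U"
    using assms by (metis mem_Sigma_iff open_prod_elim)
  then obtain r1 r2 where "r1 > 0" "cball 0 r1 \<subseteq> A" "r2 > 0" "cball 0 r2 \<subseteq> B"
    by (meson open_contains_cball)
  then have "min r1 r2 > 0" and "cball 0 (min r1 r2) \<times> cball 0 (min r1 r2) \<subseteq> A \<times> B"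
    by (auto intro!: Sigma_mono simp: subset_iff)
  with AB show ?thesis by (intro that[of "min r1 r2"]) (simp, rule subset_trans)
qed

text \<open>Move from (0,0) to (t,u) along the two axis directions; on a compact square both partial
derivatives are bounded, and the mean value theorem applies to each leg.\<close>

lemma cont_diff2_on_1_increment:
  assumes "open U" and "(0, 0) \<in> U" and F: "cont_diff2_on 1 F U"
  obtains r M where "r > 0" and
    "\<And>t u. \<bar>t\<bar> < r \<Longrightarrow> \<bar>u\<bar> < r \<Longrightarrow> \<bar>F (t, u) - F (0, 0)\<bar> \<le> M * (\<bar>t\<bar> + \<bar>u\<bar>)"
proof -
  obtain r where "r > 0" and r: "cball 0 r \<times> cball 0 r \<subseteq> U"
    using cont_diff2_on_box[OF assms(1,2)] .
  have bound: "\<exists>M. \<forall>t u. \<bar>t\<bar> \<le> r \<longrightarrow> \<bar>u\<bar> \<le> r \<longrightarrow> \<bar>P (t, u)\<bar> \<le> M"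
    if "continuous_on U P" for P :: "real \<times> real \<Rightarrow> real"
  proof -
    have "bounded (P ` (cball 0 r \<times> cball 0 r))"
      using that r by (intro compact_imp_bounded compact_continuous_image compact_Times compact_cball)
        (auto intro: continuous_on_subset)
    then obtain M where M: "\<And>x. x \<in> cball 0 r \<times> cball 0 r \<Longrightarrow> norm (P x) \<le> M"
      unfolding bounded_iff by blast
    have "\<bar>P (t, u)\<bar> \<le> M" if "\<bar>t\<bar> \<le> r" "\<bar>u\<bar> \<le> r" for t u
      using M[of "(t, u)"] that by simp
    then show ?thesis by blast
  qed
  have "continuous_on U (partial_fst F)" "continuous_on U (partial_snd F)"
    using F by simp_all
  from this[THEN bound] obtain M1 M2 where
    M1: "\<And>t u. \<bar>t\<bar> \<le> r \<Longrightarrow> \<bar>u\<bar> \<le> r \<Longrightarrow> \<bar>partial_fst F (t, u)\<bar> \<le> M1" and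
    M2: "\<And>t u. \<bar>t\<bar> \<le> r \<Longrightarrow> \<bar>u\<bar> \<le> r \<Longrightarrow> \<bar>partial_snd F (t, u)\<bar> \<le> M2"
    by blast
  have d: "((\<lambda>t'. F (t', u)) has_real_derivative partial_fst F (t, u)) (at t)"
    "((\<lambda>u'. F (t, u')) has_real_derivative partial_snd F (t, u)) (at u)"
    if "\<bar>t\<bar> \<le> r" "\<bar>u\<bar> \<le> r" for t u
  proof -
    have "(t, u) \<in> U" using r that by (auto simp: subset_iff)
    with F have "(\<lambda>t'. F (t', u)) differentiable (at t)" "(\<lambda>u'. F (t, u')) differentiable (at u)"
      by auto
    then show "((\<lambda>t'. F (t', u)) has_real_derivative partial_fst F (t, u)) (at t)"
      "((\<lambda>u'. F (t, u')) has_real_derivative partial_snd F (t, u)) (at u)"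
      by (simp_all add: partial_fst_def partial_snd_def DERIV_deriv_iff_real_differentiable)
  qed
  define M where "M = max M1 M2"
  show ?thesis
  proof (rule that[of r M, OF \<open>r > 0\<close>])
    fix t u assume *: "\<bar>t\<bar> < r" "\<bar>u\<bar> < r"
    have "\<bar>F (t, u) - F (0, u)\<bar> \<le> M1 * \<bar>t\<bar>"
      by (rule mvt_abs_bound[where g = "\<lambda>t'. F (t', u)"]; (rule d | rule M1)) (use * in linarith)+
    moreover have "\<bar>F (0, u) - F (0, 0)\<bar> \<le> M2 * \<bar>u\<bar>"
      by (rule mvt_abs_bound[where g = "\<lambda>u'. F (0, u')"]; (rule d | rule M2)) (use * in simp_all)
    moreover have "M1 * \<bar>t\<bar> \<le> M * \<bar>t\<bar>" "M2 * \<bar>u\<bar> \<le> M * \<bar>u\<bar>"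
      by (simp_all add: M_def mult_right_mono)
    ultimately have "\<bar>F (t, u) - F (0, 0)\<bar> \<le> M * \<bar>t\<bar> + M * \<bar>u\<bar>"
      by linarith
    then show "\<bar>F (t, u) - F (0, 0)\<bar> \<le> M * (\<bar>t\<bar> + \<bar>u\<bar>)"
      by (simp only: distrib_left)
  qed
qed

text \<open>By the mean value theorem the increment in u is u times a value of the partial derivative in u
between (t,0) and (t,u), and that value differs from the one at the origin by O(|t| + |u|).\<close>

lemma cont_diff2_on_snd_increment:
  assumes "open U" and "(0, 0) \<in> U" and F: "cont_diff2_on 2 F U"
  shows "(\<lambda>(t, u). F (t, u) - F (t, 0) - partial_snd F (0, 0) * u)
           \<in> O[nhds (0, 0)](\<lambda>(t, u). u * (\<bar>t\<bar> + \<bar>u\<bar>))"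
proof -
  have F': "cont_diff2_on 1 (partial_snd F) U"
    using F unfolding numeral_2_eq_2 One_nat_def cont_diff2_on.simps(2) by blast
  obtain r1 M where "r1 > 0" and M: "\<And>t u. \<bar>t\<bar> < r1 \<Longrightarrow> \<bar>u\<bar> < r1 \<Longrightarrow>
      \<bar>partial_snd F (t, u) - partial_snd F (0, 0)\<bar> \<le> M * (\<bar>t\<bar> + \<bar>u\<bar>)"
    using cont_diff2_on_1_increment[OF assms(1,2) F'] by blast
  obtain r2 where "r2 > 0" and r2: "cball 0 r2 \<times> cball 0 r2 \<subseteq> U"
    using cont_diff2_on_box[OF assms(1,2)] .
  define r where "r = min r1 r2"
  have "r > 0" using \<open>r1 > 0\<close> \<open>r2 > 0\<close> by (simp add: r_def)
  have "\<bar>F (t, u) - F (t, 0) - partial_snd F (0, 0) * u\<bar> \<le> \<bar>M\<bar> * \<bar>u * (\<bar>t\<bar> + \<bar>u\<bar>)\<bar>"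
    if tu: "\<bar>t\<bar> < r" "\<bar>u\<bar> < r" for t u
  proof -
    define g where "g = (\<lambda>v. F (t, v) - partial_snd F (0, 0) * v)"
    have "\<bar>g u - g 0\<bar> \<le> (\<bar>M\<bar> * (\<bar>t\<bar> + \<bar>u\<bar>)) * \<bar>u\<bar>"
    proof (rule mvt_abs_bound)
      fix v assume v: "\<bar>v\<bar> \<le> \<bar>u\<bar>"
      have "(t, v) \<in> U" using tu v r2 by (auto simp: r_def subset_iff)
      then have "(\<lambda>v. F (t, v)) differentiable (at v)"
        using F unfolding numeral_2_eq_2 cont_diff2_on.simps(2) by blast
      then have "((\<lambda>v. F (t, v)) has_real_derivative partial_snd F (t, v)) (at v)"
        by (simp add: partial_snd_def DERIV_deriv_iff_real_differentiable)
      then show "(g has_real_derivative partial_snd F (t, v) - partial_snd F (0, 0)) (at v)"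
        unfolding g_def by (auto intro!: derivative_eq_intros)
      have "\<bar>partial_snd F (t, v) - partial_snd F (0, 0)\<bar> \<le> M * (\<bar>t\<bar> + \<bar>v\<bar>)"
        using M[of t v] tu v by (simp add: r_def)
      also have "\<dots> \<le> \<bar>M\<bar> * (\<bar>t\<bar> + \<bar>u\<bar>)"
        using v by (intro mult_mono) auto
      finally show "\<bar>partial_snd F (t, v) - partial_snd F (0, 0)\<bar> \<le> \<bar>M\<bar> * (\<bar>t\<bar> + \<bar>u\<bar>)" .
    qed
    also have "g u - g 0 = F (t, u) - F (t, 0) - partial_snd F (0, 0) * u"
      by (simp add: g_def)
    finally show ?thesis by (simp add: abs_mult mult.assoc mult.left_commute mult.commute[of "\<bar>u\<bar>"])
  qed
  moreover have "eventually (\<lambda>p. p \<in> ball 0 r \<times> ball 0 r) (nhds (0::real, 0::real))"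
    using \<open>r > 0\<close> by (intro eventually_nhds_in_open open_Times) auto
  ultimately show ?thesis
    by (intro bigoI[where c = "\<bar>M\<bar>"]) (auto elim!: eventually_mono)
qed

lemma cont_diff2_on_Suc_imp: "cont_diff2_on (Suc k) F U \<Longrightarrow> cont_diff2_on k F U"
proof (induction k arbitrary: F)
  case 0
  then show ?case by simp
next
  case (Suc k)
  from Suc.prems have "cont_diff2_on (Suc k) (partial_fst F) U" "cont_diff2_on (Suc k) (partial_snd F) U"
    unfolding cont_diff2_on.simps(2)[of "Suc k"] by blast+
  from this[THEN Suc.IH] Suc.prems show ?case
    unfolding cont_diff2_on.simps(2) by blast
qed

text \<open>An expansion adapted to u being about as small as t^3: with t = O(e) and u = O(e^3) the remainder
is O(e^4). It combines the one-variable expansion on the line u = 0 with a first-order step in u.\<close>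

lemma cont_diff2_on_weighted_taylor:
  assumes "open U" and "(0, 0) \<in> U" and F: "cont_diff2_on 4 F U"
  shows "(\<lambda>(t, u). F (t, u) - (mixed_partial 0 0 F (0, 0) + mixed_partial 1 0 F (0, 0) * t
             + mixed_partial 2 0 F (0, 0) / 2 * t ^ 2 + mixed_partial 3 0 F (0, 0) / 6 * t ^ 3
             + mixed_partial 0 1 F (0, 0) * u))
           \<in> O[nhds (0, 0)](\<lambda>(t, u). t ^ 4 + \<bar>u\<bar> * (\<bar>t\<bar> + \<bar>u\<bar>))"
proof -
  let ?g = "\<lambda>(t, u). t ^ 4 + \<bar>u\<bar> * (\<bar>t\<bar> + \<bar>u\<bar>) :: real"
  let ?T = "\<lambda>t. \<Sum>i<4. (deriv ^^ i) (\<lambda>t. F (t, 0)) 0 / fact i * t ^ i"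
  have "open {t. (t, 0) \<in> U}"
    using open_vimage[OF \<open>open U\<close>, of "\<lambda>t. (t, 0)"] by (simp add: vimage_def continuous_intros)
  then have "(\<lambda>t. F (0 + t, 0) - ?T t) \<in> O[nhds 0](\<lambda>t. t ^ 4)"
    using assms(2) by (intro cont_diff_on_taylor_bigo[where f = "\<lambda>t. F (t, 0)", OF _ cont_diff_on_fst_slice[OF F]]) simp_all
  moreover have "filterlim fst (nhds (0::real)) (nhds (0, 0::real))"
    using tendsto_fst[OF filterlim_ident, of "(0, 0)"] by simp
  ultimately have "(\<lambda>p. F (0 + fst p, 0) - ?T (fst p)) \<in> O[nhds (0, 0 :: real)](\<lambda>p. fst p ^ 4)"
    by (rule landau_o.big.compose)
  also have "(\<lambda>p. fst p ^ 4) \<in> O[nhds (0, 0)](?g)"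
    by (rule bigoI[where c = 1]) (auto simp: case_prod_beta intro!: always_eventually)
  finally have 1: "(\<lambda>p. F (0 + fst p, 0) - ?T (fst p)) \<in> O[nhds (0, 0)](?g)" .
  have "cont_diff2_on 2 F U"
    using F cont_diff2_on_Suc_imp[of 3 F U] cont_diff2_on_Suc_imp[of 2 F U] by simp
  note cont_diff2_on_snd_increment[OF assms(1,2) this]
  also have "(\<lambda>(t, u). u * (\<bar>t\<bar> + \<bar>u\<bar>)) \<in> O[nhds (0, 0)](?g)"
    by (rule bigoI[where c = 1]) (auto simp: case_prod_beta abs_mult intro!: always_eventually)
  finally have 2: "(\<lambda>(t, u). F (t, u) - F (t, 0) - partial_snd F (0, 0) * u) \<in> O[nhds (0, 0)](?g)" .
  have T: "?T t = mixed_partial 0 0 F (0, 0) + mixed_partial 1 0 F (0, 0) * t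
             + mixed_partial 2 0 F (0, 0) / 2 * t ^ 2 + mixed_partial 3 0 F (0, 0) / 6 * t ^ 3" for t
    unfolding iterated_deriv_fst mixed_partial_def by (simp add: eval_nat_numeral)
  have "(\<lambda>p. (case p of (t, u) \<Rightarrow> F (t, u) - F (t, 0) - partial_snd F (0, 0) * u)
        + (F (0 + fst p, 0) - ?T (fst p)))
      = (\<lambda>(t, u). F (t, u) - (mixed_partial 0 0 F (0, 0) + mixed_partial 1 0 F (0, 0) * t
             + mixed_partial 2 0 F (0, 0) / 2 * t ^ 2 + mixed_partial 3 0 F (0, 0) / 6 * t ^ 3
             + mixed_partial 0 1 F (0, 0) * u))"
    unfolding T by (auto simp: fun_eq_iff mixed_partial_def)
  with sum_in_bigo(1)[OF 2 1] show ?thesis by (simp only:)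
qed

section \<open>The error ratios of the three substeps\<close>

text \<open>A(h) stands for f(r + h) / (k h) and B(h) for f'(r + h) / k, where r is a simple zero of f and
k = f'(r). The coefficients of B are those of the derivative of h A(h).\<close>

locale simple_zero_jets =
  fixes A B :: "real \<Rightarrow> real" and a b c :: real
  assumes A: "cubic_jet A 1 a b c" and B: "cubic_jet B 1 (2 * a) (3 * b) (4 * c)"
begin

text \<open>Error ratios: e w is the error of the Newton point y, and e w q that of the second point z.
The functions t, u and s are f(y)/f(x), f(z)/f(x) and f(z)/f(y) with common factors cancelled,
so that they extend continuously to e = 0.\<close>

definition w where "w e = 1 - A e / B e"
definition t where "t e = w e * A (e * w e) / A e"
definition q where "q e = 1 - A (e * w e) / ((1 - t e)\<^sup>2 * B e)"
definition s where "s e = q e * A (e * w e * q e) / A (e * w e)"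
definition u where "u e = w e * q e * A (e * w e * q e) / A e"

lemma w_jet: "cubic_jet w 0 a (2 * b - 2 * a\<^sup>2) (3 * c - 7 * a * b + 4 * a ^ 3)"
proof -
  have "cubic_jet (\<lambda>e. A e / B e) 1 (- a) (2 * a\<^sup>2 - 2 * b) (- 3 * c + 7 * a * b - 4 * a ^ 3)"
    by (rule cubic_jet_divide[OF A B]) (simp, algebra+)
  from cubic_jet_coeffs_cong[OF cubic_jet_diff[OF cubic_jet_const[of 1] this]]
  show ?thesis unfolding w_def by simp
qed

lemma w_bigo: "w \<in> O[nhds 0](\<lambda>e. e)"
  using cubic_jet_imp_bigo(1)[OF w_jet] by simp

lemma newton_error_bigo: "(\<lambda>e. e * w e) \<in> O[nhds 0](\<lambda>e. e ^ 2)"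
  using landau_o.big.mult[OF landau_o.big_refl w_bigo] by (simp add: power2_eq_square)

lemma newton_error_tendsto: "((\<lambda>e. e * w e) \<longlongrightarrow> 0) (nhds 0)"
  using tendsto_mult[OF filterlim_ident cubic_jet_tendsto[OF w_jet]] by simp

text \<open>The argument e w is O(e^2), so A only contributes its linear part modulo O(e^4).\<close>

lemma A_newton_jet: "cubic_jet (\<lambda>e. A (e * w e)) 1 0 (a\<^sup>2) (a * (2 * b - 2 * a\<^sup>2))"
proof -
  have "(\<lambda>e. A (e * w e) - (1 + a * (e * w e))) \<in> O[nhds 0](\<lambda>e. (e * w e) ^ 2)"
    by (rule landau_o.big.compose[OF cubic_jet_imp_bigo(2)[OF A] newton_error_tendsto])
  also have "(\<lambda>e. (e * w e) ^ 2) \<in> O[nhds 0](\<lambda>e. e ^ 4)"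
    using landau_o.big_power[OF newton_error_bigo, of 2] by (simp flip: power_mult)
  finally have d: "(\<lambda>e. A (e * w e) - (1 + a * (e * w e))) \<in> O[nhds 0](\<lambda>e. e ^ 4)" .
  have "cubic_jet (\<lambda>e. 1 + a * (e * w e)) 1 0 (a\<^sup>2) (a * (2 * b - 2 * a\<^sup>2))"
    by (rule cubic_jet_coeffs_cong[OF cubic_jet_add[OF cubic_jet_const cubic_jet_mult[OF cubic_jet_const
          cubic_jet_mult[OF cubic_jet_ident w_jet]]]]) (simp_all add: power2_eq_square)
  then show ?thesis using d by (rule cubic_jet_cong_bigo)
qed

lemma t_jet: "cubic_jet t 0 a (2 * b - 3 * a\<^sup>2) (3 * c - 10 * a * b + 8 * a ^ 3)"
  unfolding t_def by (rule cubic_jet_divide[OF cubic_jet_mult[OF w_jet A_newton_jet] A]) (simp, algebra+)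

text \<open>A(e w) has no linear term, and the factor (1 - t)^2 removes the linear term 2 a e of B; so the
quotient is 1 + O(e^2), which makes the second point a fourth-order approximation.\<close>

lemma q_jet: "cubic_jet q 0 0 (2 * a\<^sup>2 - b) (- 6 * a ^ 3 + 8 * a * b - 2 * c)"
proof -
  note o = cubic_jet_diff[OF cubic_jet_const[of 1] t_jet]
  have "cubic_jet (\<lambda>e. A (e * w e) / ((1 - t e) * (1 - t e) * B e))
      1 0 (- (2 * a\<^sup>2 - b)) (6 * a ^ 3 - 8 * a * b + 2 * c)"
    by (rule cubic_jet_divide[OF A_newton_jet cubic_jet_mult[OF cubic_jet_mult[OF o o] B]]) (simp, algebra+)
  from cubic_jet_coeffs_cong[OF cubic_jet_diff[OF cubic_jet_const[of 1] this]]
  show ?thesis unfolding q_def power2_eq_square[of "1 - t _"] by simp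
qed

lemma second_error_bigo: "(\<lambda>e. e * w e * q e) \<in> O[nhds 0](\<lambda>e. e ^ 4)"
  using landau_o.big.mult[OF newton_error_bigo cubic_jet_imp_bigo(2)[OF q_jet]]
  by (simp flip: power_add)

lemma second_error_tendsto: "((\<lambda>e. e * w e * q e) \<longlongrightarrow> 0) (nhds 0)"
  using tendsto_mult[OF newton_error_tendsto cubic_jet_tendsto[OF q_jet]] by simp

lemma A_second_jet: "cubic_jet (\<lambda>e. A (e * w e * q e)) 1 0 0 0"
proof -
  have "(\<lambda>e. A (e * w e * q e) - 1) \<in> O[nhds 0](\<lambda>e. e * w e * q e)"
    by (rule landau_o.big.compose[OF cubic_jet_imp_bigo(1)[OF A] second_error_tendsto])
  from landau_o.big_trans[OF this second_error_bigo] show ?thesis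
    by (rule cubic_jet_cong_bigo[OF cubic_jet_const])
qed

lemma s_jet: "cubic_jet s 0 0 (2 * a\<^sup>2 - b) (- 6 * a ^ 3 + 8 * a * b - 2 * c)"
  unfolding s_def
  by (rule cubic_jet_divide[OF cubic_jet_mult[OF q_jet A_second_jet] A_newton_jet]) (simp, algebra+)

lemma u_jet: "cubic_jet u 0 0 0 (a * (2 * a\<^sup>2 - b))"
  unfolding u_def
  by (rule cubic_jet_divide[OF cubic_jet_mult[OF cubic_jet_mult[OF w_jet q_jet] A_second_jet] A])
    (simp, algebra+)

lemma weight_fst_jet:
  assumes J: "(\<lambda>(t, u). J (t, u) - (1 + 2 * t + 4 * t\<^sup>2 + 6 * t ^ 3 + 2 * u))
                \<in> O[nhds (0, 0)](\<lambda>(t, u). t ^ 4 + \<bar>u\<bar> * (\<bar>t\<bar> + \<bar>u\<bar>))"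
  shows "cubic_jet (\<lambda>e. J (t e, u e)) 1 (2 * a) (4 * b - 2 * a\<^sup>2) (6 * c - 6 * a * b + 2 * a ^ 3)"
proof -
  have "filterlim (\<lambda>e. (t e, u e)) (nhds (0, 0)) (nhds 0)"
    by (intro tendsto_Pair cubic_jet_tendsto[OF t_jet] cubic_jet_tendsto[OF u_jet])
  from landau_o.big.compose[OF J this]
  have "(\<lambda>e. J (t e, u e) - (1 + 2 * t e + 4 * (t e * t e) + 6 * (t e * (t e * t e)) + 2 * u e))
      \<in> O[nhds 0](\<lambda>e. t e ^ 4 + \<bar>u e\<bar> * (\<bar>t e\<bar> + \<bar>u e\<bar>))"
    by (simp add: power2_eq_square power3_eq_cube mult.assoc)
  also have "(\<lambda>e. t e ^ 4 + \<bar>u e\<bar> * (\<bar>t e\<bar> + \<bar>u e\<bar>)) \<in> O[nhds 0](\<lambda>e. e ^ 4)"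
  proof (rule sum_in_bigo(1))
    have t: "t \<in> O[nhds 0](\<lambda>e. e)" using cubic_jet_imp_bigo(1)[OF t_jet] by simp
    have u: "u \<in> O[nhds 0](\<lambda>e. e ^ 3)" using cubic_jet_imp_bigo(3)[OF u_jet] by simp
    have u1: "u \<in> O[nhds 0](\<lambda>e. e)" using cubic_jet_imp_bigo(1)[OF u_jet] by simp
    show "(\<lambda>e. t e ^ 4) \<in> O[nhds 0](\<lambda>e. e ^ 4)" by (rule landau_o.big_power[OF t])
    have "(\<lambda>e. \<bar>u e\<bar> * (\<bar>t e\<bar> + \<bar>u e\<bar>)) \<in> O[nhds 0](\<lambda>e. e ^ 3 * e)"
      using t u u1 by (intro landau_o.big.mult sum_in_bigo) simp_all
    then show "(\<lambda>e. \<bar>u e\<bar> * (\<bar>t e\<bar> + \<bar>u e\<bar>)) \<in> O[nhds 0](\<lambda>e. e ^ 4)"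
      by (simp add: power_Suc2[symmetric] del: power_Suc)
  qed
  finally have d: "(\<lambda>e. J (t e, u e) - (1 + 2 * t e + 4 * (t e * t e) + 6 * (t e * (t e * t e)) + 2 * u e))
      \<in> O[nhds 0](\<lambda>e. e ^ 4)" .
  note tt = cubic_jet_mult[OF t_jet t_jet]
  have "cubic_jet (\<lambda>e. 1 + 2 * t e + 4 * (t e * t e) + 6 * (t e * (t e * t e)) + 2 * u e)
      1 (2 * a) (4 * b - 2 * a\<^sup>2) (6 * c - 6 * a * b + 2 * a ^ 3)"
    by (rule cubic_jet_coeffs_cong[OF
          cubic_jet_add[OF cubic_jet_add[OF cubic_jet_add[OF cubic_jet_add[OF cubic_jet_const
            cubic_jet_mult[OF cubic_jet_const t_jet]] cubic_jet_mult[OF cubic_jet_const tt]]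
            cubic_jet_mult[OF cubic_jet_const cubic_jet_mult[OF t_jet tt]]]
            cubic_jet_mult[OF cubic_jet_const u_jet]]]) algebra+
  then show ?thesis using d by (rule cubic_jet_cong_bigo)
qed

lemma weight_snd_jet:
  assumes G: "(\<lambda>s. G s - (1 + s)) \<in> O[nhds 0](\<lambda>s. s\<^sup>2)"
  shows "cubic_jet (\<lambda>e. G (s e)) 1 0 (2 * a\<^sup>2 - b) (- 6 * a ^ 3 + 8 * a * b - 2 * c)"
proof -
  have "(\<lambda>e. G (s e) - (1 + s e)) \<in> O[nhds 0](\<lambda>e. (s e)\<^sup>2)"
    by (rule landau_o.big.compose[OF G cubic_jet_tendsto[OF s_jet]])
  also have "(\<lambda>e. (s e)\<^sup>2) \<in> O[nhds 0](\<lambda>e. e ^ 4)"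
    using landau_o.big_power[OF cubic_jet_imp_bigo(2)[OF s_jet], of 2] by (simp flip: power_mult)
  finally show ?thesis
    using cubic_jet_cong_bigo[OF cubic_jet_add[OF cubic_jet_const[of 1] s_jet]] by simp
qed

text \<open>The decisive cancellation: J(t, u) G(s) and B have the same expansion modulo O(e^4), so the last
factor contributes four orders on top of the four of e w q.\<close>

lemma third_error_bigo:
  assumes J: "(\<lambda>(t, u). J (t, u) - (1 + 2 * t + 4 * t\<^sup>2 + 6 * t ^ 3 + 2 * u))
                \<in> O[nhds (0, 0)](\<lambda>(t, u). t ^ 4 + \<bar>u\<bar> * (\<bar>t\<bar> + \<bar>u\<bar>))"
    and G: "(\<lambda>s. G s - (1 + s)) \<in> O[nhds 0](\<lambda>s. s\<^sup>2)"
  shows "(\<lambda>e. e * w e * q e * (1 - A (e * w e * q e) / B e * J (t e, u e) * G (s e))) \<in> O[nhds 0](\<lambda>e. e ^ 8)"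
proof -
  have "cubic_jet (\<lambda>e. A (e * w e * q e) * (J (t e, u e) * G (s e)) / B e) 1 0 0 0"
    by (rule cubic_jet_divide[OF cubic_jet_mult[OF A_second_jet
          cubic_jet_mult[OF weight_fst_jet[OF J] weight_snd_jet[OF G]]] B]) (simp, algebra+)
  from cubic_jet_diff[OF cubic_jet_const[of 1] this]
  have "(\<lambda>e. 1 - A (e * w e * q e) / B e * J (t e, u e) * G (s e)) \<in> O[nhds 0](\<lambda>e. e ^ 4)"
    by (simp add: cubic_jet_def mult.assoc)
  from landau_o.big.mult[OF second_error_bigo this] show ?thesis
    by (simp flip: power_add)
qed

end

section \<open>From asymptotics of one step to convergence of the iteration\<close>

text \<open>Superlinear smallness of the step error implies that near the fixed point the error is at least
halved in each step, so the iteration cannot leave the neighbourhood and converges; the order is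
then the one-step bound read along the sequence.\<close>

lemma converges_with_order_if_step_bigo:
  fixes \<Phi> :: "real \<Rightarrow> real"
  assumes step: "(\<lambda>x. \<Phi> x - a) \<in> O[nhds a](\<lambda>x. (x - a) ^ p)" and "p \<ge> 2"
    and P: "eventually P (nhds a)"
  shows "\<exists>\<delta>>0. \<forall>x. \<bar>x 0 - a\<bar> < \<delta> \<longrightarrow> (\<forall>n. x (Suc n) = \<Phi> (x n)) \<longrightarrow>
           (\<forall>n. P (x n)) \<and> converges_with_order x a p"
proof -
  obtain C where "C > 0" and C: "eventually (\<lambda>x. norm (\<Phi> x - a) \<le> C * norm ((x - a) ^ p)) (nhds a)"
    using step by (rule landau_o.bigE)
  obtain d where "d > 0"
    and d: "\<And>x. \<bar>x - a\<bar> < d \<Longrightarrow> P x \<and> \<bar>\<Phi> x - a\<bar> \<le> C * \<bar>x - a\<bar> ^ p"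
    using eventually_conj[OF P C] by (auto simp: eventually_nhds_metric dist_real_def power_abs)
  \<comment> \<open>For |x - a| < 1 the bound C |x - a|^p is at most (C |x - a|) |x - a|,
      and |x - a| < 1 / (2 C) makes the first factor at most 1/2.\<close>
  define \<delta> where "\<delta> = min d (min 1 (1 / (2 * C)))"
  have "\<delta> > 0" using \<open>d > 0\<close> \<open>C > 0\<close> by (simp add: \<delta>_def)
  have half: "\<bar>\<Phi> x - a\<bar> \<le> 1 / 2 * \<bar>x - a\<bar>" if "\<bar>x - a\<bar> < \<delta>" for x
  proof -
    have "\<bar>x - a\<bar> ^ p \<le> \<bar>x - a\<bar> ^ 2"
      using that \<open>p \<ge> 2\<close> by (intro power_decreasing) (auto simp: \<delta>_def)
    then have "C * \<bar>x - a\<bar> ^ p \<le> C * \<bar>x - a\<bar> ^ 2"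
      using \<open>C > 0\<close> by (intro mult_left_mono) simp_all
    then have "\<bar>\<Phi> x - a\<bar> \<le> C * \<bar>x - a\<bar> ^ 2"
      using d[of x] that by (simp add: \<delta>_def)
    also have "\<dots> = (C * \<bar>x - a\<bar>) * \<bar>x - a\<bar>" by (simp add: power2_eq_square)
    also have "\<dots> \<le> 1 / 2 * \<bar>x - a\<bar>"
      using that \<open>C > 0\<close> by (intro mult_right_mono) (auto simp: \<delta>_def field_simps)
    finally show ?thesis .
  qed
  show ?thesis
  proof (intro exI[of _ \<delta>] conjI allI impI \<open>\<delta> > 0\<close>)
    fix x :: "nat \<Rightarrow> real"
    assume x0: "\<bar>x 0 - a\<bar> < \<delta>" and rec: "\<forall>n. x (Suc n) = \<Phi> (x n)"
    have geo: "\<bar>x n - a\<bar> < \<delta> \<and> \<bar>x n - a\<bar> \<le> (1 / 2) ^ n * \<bar>x 0 - a\<bar>" for n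
    proof (induction n)
      case (Suc n)
      then have "\<bar>x (Suc n) - a\<bar> \<le> 1 / 2 * \<bar>x n - a\<bar>"
        using half[of "x n"] rec by simp
      moreover have "\<bar>x n - a\<bar> < \<delta>" and "\<bar>x n - a\<bar> \<le> (1 / 2) ^ n * \<bar>x 0 - a\<bar>"
        using Suc by simp_all
      ultimately have "\<bar>x (Suc n) - a\<bar> < \<delta> \<and>
          \<bar>x (Suc n) - a\<bar> \<le> 1 / 2 * ((1 / 2) ^ n * \<bar>x 0 - a\<bar>)"
        using abs_ge_zero[of "x n - a"] by argo
      then show ?case by simp
    qed (use x0 in simp)
    then show "P (x n)" for n using d[of "x n"] by (simp add: \<delta>_def)
    have "(\<lambda>n. x n - a) \<longlonglongrightarrow> 0"
    proof (rule Lim_null_comparison)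
      show "eventually (\<lambda>n. norm (x n - a) \<le> (1 / 2) ^ n * \<bar>x 0 - a\<bar>) sequentially"
        using geo by simp
      show "(\<lambda>n. (1 / 2) ^ n * \<bar>x 0 - a\<bar>) \<longlonglongrightarrow> 0"
        by (intro tendsto_mult_left_zero LIMSEQ_power_zero) simp
    qed
    then have "x \<longlonglongrightarrow> a" by (rule LIM_zero_cancel)
    moreover have "(\<lambda>n. x (Suc n) - a) \<in> O(\<lambda>n. (x n - a) ^ p)"
      using landau_o.big.compose[OF step \<open>x \<longlonglongrightarrow> a\<close>] rec by simp
    ultimately show "converges_with_order x a p"
      by (simp add: converges_with_order_def)
  qed
qed

section \<open>The iteration near a simple zero\<close>

definition newton_step :: "(real \<Rightarrow> real) \<Rightarrow> real \<Rightarrow> real" where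
  "newton_step f x = x - f x / deriv f x"

definition second_step :: "(real \<Rightarrow> real) \<Rightarrow> real \<Rightarrow> real" where
  "second_step f x = (let y = newton_step f x in
     y - f x * f y / (f x - f y)\<^sup>2 * (f x / deriv f x))"

definition third_step :: "(real \<times> real \<Rightarrow> real) \<Rightarrow> (real \<Rightarrow> real) \<Rightarrow> (real \<Rightarrow> real) \<Rightarrow> real \<Rightarrow> real" where
  "third_step J G f x = (let y = newton_step f x; z = second_step f x in
     z - f z / deriv f x * J (f y / f x, f z / f x) * G (f z / f y))"

text \<open>The equations are required for all h, including h = 0; there the first one says that f vanishes
at r, and it leaves the value A 0 to be fixed by continuity.\<close>

locale normalized_simple_zero = simple_zero_jets +
  fixes f :: "real \<Rightarrow> real" and r k :: real
  assumes k: "k \<noteq> 0"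
    and f_eq: "f (r + h) = k * h * A h"
    and deriv_eq: "deriv f (r + h) = k * B h"
begin

lemma newton_step_eq: "newton_step f (r + e) = r + e * w e"
  using k by (simp add: newton_step_def f_eq deriv_eq w_def right_diff_distrib)

lemma second_step_eq:
  assumes "A e \<noteq> 0" and "t e \<noteq> 1"
  shows "second_step f (r + e) = r + e * w e * q e"
proof (cases "e = 0")
  case True
  then show ?thesis using f_eq[of 0] by (simp add: second_step_def newton_step_def)
next
  case False
  have fx: "f (r + e) \<noteq> 0" using assms k False by (simp add: f_eq)
  have fy: "f (r + e * w e) = t e * f (r + e)"
    using assms by (simp add: f_eq t_def)
  have "f (r + e) * f (r + e * w e) / (f (r + e) - f (r + e * w e))\<^sup>2 * (f (r + e) / deriv f (r + e))
      = f (r + e * w e) * ((f (r + e))\<^sup>2 / (f (r + e) - f (r + e * w e))\<^sup>2) / deriv f (r + e)"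
    by (simp add: power2_eq_square)
  also have "(f (r + e))\<^sup>2 / (f (r + e) - f (r + e * w e))\<^sup>2 = 1 / (1 - t e)\<^sup>2"
  proof -
    have "f (r + e) - f (r + e * w e) = f (r + e) * (1 - t e)" by (simp add: fy right_diff_distrib)
    then show ?thesis using fx by (simp add: power_mult_distrib)
  qed
  also have "f (r + e * w e) * (1 / (1 - t e)\<^sup>2) / deriv f (r + e) = e * w e * (1 - q e)"
    using k by (simp add: f_eq deriv_eq q_def)
  finally show ?thesis
    by (simp add: second_step_def newton_step_eq right_diff_distrib)
qed

text \<open>If the Newton point is r itself, then s is the quotient 0/0, but f(z) = 0 makes its value irrelevant:
both sides equal r.\<close>

lemma third_step_eq:
  assumes "A e \<noteq> 0" and "t e \<noteq> 1" and "A (e * w e) \<noteq> 0"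
  shows "third_step J G f (r + e)
    = r + e * w e * q e * (1 - A (e * w e * q e) / B e * J (t e, u e) * G (s e))"
proof (cases "e * w e = 0")
  case True
  then have "second_step f (r + e) = r" using second_step_eq[OF assms(1,2)] by simp
  then show ?thesis using True f_eq[of 0] by (simp add: third_step_def)
next
  case False
  then have ratios: "f (r + e * w e) / f (r + e) = t e" "f (r + e * w e * q e) / f (r + e) = u e"
    "f (r + e * w e * q e) / f (r + e * w e) = s e"
    using k assms by (simp_all add: f_eq t_def u_def s_def)
  have correction: "f (r + e * w e * q e) / deriv f (r + e) = e * w e * q e * (A (e * w e * q e) / B e)"
    using k by (simp add: f_eq deriv_eq)
  show ?thesis
    unfolding third_step_def Let_def newton_step_eq second_step_eq[OF assms(1,2)] ratios correction
    by (simp add: right_diff_distrib mult.assoc)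
qed

lemma eventually_regular:
  "eventually (\<lambda>e. A e \<noteq> 0 \<and> B e \<noteq> 0 \<and> t e \<noteq> 1 \<and> A (e * w e) \<noteq> 0) (nhds 0)"
  using cubic_jet_tendsto[OF A] cubic_jet_tendsto[OF B] cubic_jet_tendsto[OF t_jet]
    cubic_jet_tendsto[OF A_newton_jet]
  by (intro eventually_conj; elim tendsto_imp_eventually_ne) simp_all

lemma third_step_bigo:
  assumes J: "(\<lambda>(t, u). J (t, u) - (1 + 2 * t + 4 * t\<^sup>2 + 6 * t ^ 3 + 2 * u))
                \<in> O[nhds (0, 0)](\<lambda>(t, u). t ^ 4 + \<bar>u\<bar> * (\<bar>t\<bar> + \<bar>u\<bar>))"
    and G: "(\<lambda>s. G s - (1 + s)) \<in> O[nhds 0](\<lambda>s. s\<^sup>2)"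
  shows "(\<lambda>x. third_step J G f x - r) \<in> O[nhds r](\<lambda>x. (x - r) ^ 8)"
proof -
  have "eventually (\<lambda>e. third_step J G f (r + e) - r
      = e * w e * q e * (1 - A (e * w e * q e) / B e * J (t e, u e) * G (s e))) (nhds 0)"
    using eventually_regular by eventually_elim (simp add: third_step_eq)
  then have "(\<lambda>e. third_step J G f (r + e) - r) \<in> O[nhds 0](\<lambda>e. e ^ 8)"
    using third_error_bigo[OF J G] by (simp add: landau_o.big.in_cong)
  moreover have "filterlim (\<lambda>x. x - r) (nhds 0) (nhds r)"
    using tendsto_diff[OF filterlim_ident tendsto_const, of r r] by simp
  ultimately have "(\<lambda>x. third_step J G f (r + (x - r)) - r) \<in> O[nhds r](\<lambda>x. (x - r) ^ 8)"
    by (rule landau_o.big.compose)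
  then show ?thesis by simp
qed

lemma eventually_well_defined:
  assumes "open D" and "r \<in> D"
  shows "eventually (\<lambda>x. x \<in> D \<and> newton_step f x \<in> D \<and> second_step f x \<in> D \<and> deriv f x \<noteq> 0 \<and>
     (x \<noteq> r \<longrightarrow> f x \<noteq> 0 \<and> f x \<noteq> f (newton_step f x)) \<and>
     (newton_step f x \<noteq> r \<longrightarrow> f (newton_step f x) \<noteq> 0)) (nhds r)"
proof -
  have "eventually (\<lambda>e. r + h e \<in> D) (nhds 0)" if "(h \<longlongrightarrow> 0) (nhds 0)" for h :: "real \<Rightarrow> real"
    using topological_tendstoD[OF tendsto_add[OF tendsto_const that] assms(1)] assms(2) by simp
  note in_D = this[OF filterlim_ident] this[OF newton_error_tendsto] this[OF second_error_tendsto]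
  let ?P = "\<lambda>x. x \<in> D \<and> newton_step f x \<in> D \<and> second_step f x \<in> D \<and> deriv f x \<noteq> 0 \<and>
     (x \<noteq> r \<longrightarrow> f x \<noteq> 0 \<and> f x \<noteq> f (newton_step f x)) \<and>
     (newton_step f x \<noteq> r \<longrightarrow> f (newton_step f x) \<noteq> 0)"
  have "eventually (\<lambda>e. ?P (r + e)) (nhds 0)"
    using eventually_regular in_D
  proof eventually_elim
    case (elim e)
    have fy: "f (r + e * w e) = t e * f (r + e)"
      using elim by (simp add: f_eq t_def)
    have fx: "f (r + e) \<noteq> 0" if "e \<noteq> 0"
      using that elim k by (simp add: f_eq)
    have "f (r + e) \<noteq> f (r + e * w e)" if "e \<noteq> 0"
      using fx[OF that] elim by (simp add: fy)
    moreover have "f (r + e * w e) \<noteq> 0" if "e * w e \<noteq> 0"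
      using that elim k by (simp add: f_eq)
    moreover have "second_step f (r + e) = r + e * w e * q e"
      using elim by (intro second_step_eq) simp_all
    moreover have "deriv f (r + e) \<noteq> 0"
      using elim k by (simp add: deriv_eq)
    ultimately show ?case
      using elim fx unfolding newton_step_eq by simp
  qed
  moreover have "filterlim (\<lambda>x. x - r) (nhds 0) (nhds r)"
    using tendsto_diff[OF filterlim_ident tendsto_const, of r r] by simp
  ultimately have "eventually (\<lambda>x. ?P (r + (x - r))) (nhds r)"
    by (rule eventually_compose_filterlim)
  then show ?thesis by simp
qed

end

lemma cont_diff_on_le: "cont_diff_on k f D \<Longrightarrow> j \<le> k \<Longrightarrow> cont_diff_on j f D"
  by (auto simp: cont_diff_on_def)

lemma cont_diff_on_deriv:
  assumes "cont_diff_on (Suc k) f D"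
  shows "cont_diff_on k (deriv f) D"
proof -
  have "(deriv ^^ j) (deriv f) = (deriv ^^ Suc j) f" for j
    by (simp only: funpow_Suc_right o_apply)
  with assms show ?thesis by (simp add: cont_diff_on_def del: funpow.simps)
qed

text \<open>A is the difference quotient of f at r, scaled by 1/k and continued by 1; its expansion to third
order is the fifth-order Taylor formula of f divided by k h.\<close>

lemma normalized_simple_zero_exists:
  assumes "open D" and f: "cont_diff_on 8 f D" and "r \<in> D" and "simple_zero f r"
  shows "\<exists>A B a b c. normalized_simple_zero A B a b c f r (deriv f r)"
proof -
  define k where "k = deriv f r"
  have k: "k \<noteq> 0" and f0: "f r = 0" using assms(4) by (simp_all add: simple_zero_def k_def)
  define a where "a = (deriv ^^ 2) f r / (2 * k)"
  define b where "b = (deriv ^^ 3) f r / (6 * k)"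
  define c where "c = (deriv ^^ 4) f r / (24 * k)"
  define A where "A h = (if h = 0 then 1 else f (r + h) / (k * h))" for h
  define B where "B h = deriv f (r + h) / k" for h
  have f5: "cont_diff_on 5 f D" and f4: "cont_diff_on 4 (deriv f) D"
    using cont_diff_on_le[OF f] cont_diff_on_deriv[of 4 f D] by auto
  have 1: "(\<lambda>h. f (r + h) - k * h * (1 + a * h + b * h ^ 2 + c * h ^ 3)) \<in> O[nhds 0](\<lambda>h. h ^ 5)"
    using cont_diff_on_taylor_bigo[OF assms(1) f5 assms(3)] f0 k
    by (simp add: eval_nat_numeral k_def[symmetric] a_def b_def c_def algebra_simps)
  have 2: "(\<lambda>h. deriv f (r + h) - k * (1 + 2 * a * h + 3 * b * h ^ 2 + 4 * c * h ^ 3)) \<in> O[nhds 0](\<lambda>h. h ^ 4)"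
    using cont_diff_on_taylor_bigo[OF assms(1) f4 assms(3)] k
    by (simp add: eval_nat_numeral k_def[symmetric] a_def b_def c_def algebra_simps)
  have fA: "f (r + h) = k * h * A h" for h
    using k f0 by (simp add: A_def)
  have "cubic_jet B 1 (2 * a) (3 * b) (4 * c)"
  proof -
    have "(\<lambda>h. inverse k * (deriv f (r + h) - k * (1 + 2 * a * h + 3 * b * h ^ 2 + 4 * c * h ^ 3)))
        \<in> O[nhds 0](\<lambda>h. h ^ 4)"
      using 2 by simp
    then show ?thesis using k by (simp add: cubic_jet_def B_def field_simps)
  qed
  moreover have "cubic_jet A 1 a b c"
  proof -
    obtain C where C: "eventually (\<lambda>h. norm (f (r + h) - k * h * (1 + a * h + b * h ^ 2 + c * h ^ 3))
        \<le> C * norm (h ^ 5)) (nhds 0)"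
      using 1 by (rule landau_o.bigE)
    have "eventually (\<lambda>h. norm (A h - (1 + a * h + b * h ^ 2 + c * h ^ 3)) \<le> C / \<bar>k\<bar> * norm (h ^ 4)) (nhds 0)"
      using C
    proof eventually_elim
      case (elim h)
      show ?case
      proof (cases "h = 0")
        case False
        have "\<bar>k * h\<bar> * \<bar>A h - (1 + a * h + b * h ^ 2 + c * h ^ 3)\<bar> \<le> C * \<bar>h ^ 5\<bar>"
          using elim by (simp add: fA abs_mult[symmetric] right_diff_distrib[of "k * h"])
        also have "\<dots> = \<bar>k * h\<bar> * (C / \<bar>k\<bar> * \<bar>h ^ 4\<bar>)"
          using k by (simp add: abs_mult power_abs eval_nat_numeral)
        finally show ?thesis
          unfolding real_norm_def by (rule mult_left_le_imp_le) (use k False in simp)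
      qed (simp add: A_def)
    qed
    then show ?thesis unfolding cubic_jet_def by (rule bigoI)
  qed
  ultimately have "normalized_simple_zero A B a b c f r k"
    using k fA by unfold_locales (simp_all add: B_def)
  then show ?thesis unfolding k_def by blast
qed

theorem theorem1:
  fixes D :: "real set" and f :: "real \<Rightarrow> real" and xstar :: real
    and J :: "real \<times> real \<Rightarrow> real" and G :: "real \<Rightarrow> real"
  assumes "open D" and "is_interval D"
    and "cont_diff_on 8 f D"
    and "xstar \<in> D" and "simple_zero f xstar"
    and "\<exists>U. open U \<and> (0, 0) \<in> U \<and> cont_diff2_on 4 J U"
    and "\<exists>V. open V \<and> 0 \<in> V \<and> cont_diff_on 2 G V"
    and "mixed_partial 0 0 J (0, 0) = 1"
    and "mixed_partial 1 0 J (0, 0) = 2"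
    and "mixed_partial 2 0 J (0, 0) = 8"
    and "mixed_partial 0 1 J (0, 0) = 2"
    and "mixed_partial 3 0 J (0, 0) = 36"
    and "(deriv ^^ 0) G 0 = 1"
    and "(deriv ^^ 1) G 0 = 1"
  shows "\<exists>\<delta>>0. \<forall>x y z t u s :: nat \<Rightarrow> real.
    \<bar>x 0 - xstar\<bar> < \<delta> \<longrightarrow>
    (\<forall>n. y n = x n - f (x n) / deriv f (x n)) \<longrightarrow>
    (\<forall>n. z n = y n - f (x n) * f (y n) / (f (x n) - f (y n))\<^sup>2 * (f (x n) / deriv f (x n))) \<longrightarrow>
    (\<forall>n. t n = f (y n) / f (x n)) \<longrightarrow>
    (\<forall>n. u n = f (z n) / f (x n)) \<longrightarrow>
    (\<forall>n. s n = f (z n) / f (y n)) \<longrightarrow>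
    (\<forall>n. x (Suc n) = z n - f (z n) / deriv f (x n) * J (t n, u n) * G (s n)) \<longrightarrow>
    (\<forall>n. x n \<in> D \<and> y n \<in> D \<and> z n \<in> D \<and> deriv f (x n) \<noteq> 0 \<and>
         (x n \<noteq> xstar \<longrightarrow> f (x n) \<noteq> 0 \<and> f (x n) \<noteq> f (y n)) \<and>
         (y n \<noteq> xstar \<longrightarrow> f (y n) \<noteq> 0)) \<and>
    converges_with_order x xstar 8"
proof -
  obtain U where U: "open U" "(0, 0) \<in> U" "cont_diff2_on 4 J U" using assms(6) by blast
  obtain V where V: "open V" "0 \<in> V" "cont_diff_on 2 G V" using assms(7) by blast
  obtain A B a b c where "normalized_simple_zero A B a b c f xstar (deriv f xstar)"
    using normalized_simple_zero_exists[OF assms(1,3,4,5)] by blast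
  then interpret normalized_simple_zero A B a b c f xstar "deriv f xstar" .
  have "(\<lambda>(t, u). J (t, u) - (1 + 2 * t + 4 * t\<^sup>2 + 6 * t ^ 3 + 2 * u))
      \<in> O[nhds (0, 0)](\<lambda>(t, u). t ^ 4 + \<bar>u\<bar> * (\<bar>t\<bar> + \<bar>u\<bar>))"
    using cont_diff2_on_weighted_taylor[OF U] unfolding assms(8-12) by simp
  moreover have "(\<lambda>s. G s - (1 + s)) \<in> O[nhds 0](\<lambda>s. s\<^sup>2)"
    using cont_diff_on_taylor_bigo[OF V(1,3,2)] assms(13,14) by (simp add: eval_nat_numeral)
  ultimately have "(\<lambda>x. third_step J G f x - xstar) \<in> O[nhds xstar](\<lambda>x. (x - xstar) ^ 8)"
    by (rule third_step_bigo)
  from converges_with_order_if_step_bigo[OF this _ eventually_well_defined[OF assms(1,4)]]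
  obtain \<delta> where "\<delta> > 0" and \<delta>: "\<And>x. \<bar>x 0 - xstar\<bar> < \<delta> \<Longrightarrow> \<forall>n. x (Suc n) = third_step J G f (x n) \<Longrightarrow>
      (\<forall>n. x n \<in> D \<and> newton_step f (x n) \<in> D \<and> second_step f (x n) \<in> D \<and> deriv f (x n) \<noteq> 0 \<and>
        (x n \<noteq> xstar \<longrightarrow> f (x n) \<noteq> 0 \<and> f (x n) \<noteq> f (newton_step f (x n))) \<and>
        (newton_step f (x n) \<noteq> xstar \<longrightarrow> f (newton_step f (x n)) \<noteq> 0)) \<and>
      converges_with_order x xstar 8"
    by auto
  show ?thesis
  proof (intro exI[of _ \<delta>] conjI[OF \<open>\<delta> > 0\<close>] allI impI)
    fix x y z t u s :: "nat \<Rightarrow> real"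
    assume x0: "\<bar>x 0 - xstar\<bar> < \<delta>"
      and y: "\<forall>n. y n = x n - f (x n) / deriv f (x n)"
      and z: "\<forall>n. z n = y n - f (x n) * f (y n) / (f (x n) - f (y n))\<^sup>2 * (f (x n) / deriv f (x n))"
      and tus: "\<forall>n. t n = f (y n) / f (x n)" "\<forall>n. u n = f (z n) / f (x n)" "\<forall>n. s n = f (z n) / f (y n)"
      and x: "\<forall>n. x (Suc n) = z n - f (z n) / deriv f (x n) * J (t n, u n) * G (s n)"
    have y': "y n = newton_step f (x n)" for n using y by (simp add: newton_step_def)
    have z': "z n = second_step f (x n)" for n using z by (simp add: second_step_def Let_def y')
    have "\<forall>n. x (Suc n) = third_step J G f (x n)"
      using x tus by (simp add: third_step_def Let_def y' z')
    from \<delta>[OF x0 this] show "(\<forall>n. x n \<in> D \<and> y n \<in> D \<and> z n \<in> D \<and> deriv f (x n) \<noteq> 0 \<and>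
         (x n \<noteq> xstar \<longrightarrow> f (x n) \<noteq> 0 \<and> f (x n) \<noteq> f (y n)) \<and>
         (y n \<noteq> xstar \<longrightarrow> f (y n) \<noteq> 0)) \<and>
      converges_with_order x xstar 8"
      by (simp add: y' z')
  qed
qed

end
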